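(* Let $S$ be a finite simple group. The function $\mathbf{sur}_S$ on finite groups satisfies the initial condition, constructability axiom, product axiom, quotient axiom and extension axiom, and hence is a complexity function on finite groups. However, $\mathbf{sur}_S$ does not have the normal subgroup property: there are a finite group $G$ and a normal subgroup $N\lhd G$ with $\mathbf{sur}_S(N)>\mathbf{sur}_S(G)$.
   Context: For a finite simple group $S$ and a finite group $G$, $\mathbf{sur}_S(G)=1$ if there is a surjective homomorphism $G\to S$, and $\mathbf{sur}_S(G)=0$ otherwise. For a function $\mathbf{c}$ from the class of finite groups to $\mathbb{N}=\{0,1,2,\dots\}$ the complexity axioms are: (Extension) If $N\lhd G$, then $\mathbf{c}(G)\le \mathbf{c}(N)+\mathbf{c}(G/N)$. (Quotient) If there is a surjective homomorphism $G\to H$, then $\mathbf{c}(G)\ge \mathbf{c}(H)$. (Constructability) Every finite group $G$ has a subnormal series $\mathbf{1}=G_n\lhd G_{n-1}\lhd\cdots\lhd G_0=G$ (some $n\ge 0$) with $\mathbf{c}(G_i/G_{i+1})\le 1$ for all $0\le i<n$. (Product) If $G=H\times K$, then $\mathbf{c}(G)=\max(\mathbf{c}(H),\mathbf{c}(K))$. (Initial condition) $\mathbf{c}(\mathbf{1})=0$ for the trivial group $\mathbf{1}$. A complexity function is a function satisfying these five axioms. *)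

theory Defs
  imports "HOL-Algebra.Algebra" "HOL-Library.Infinite_Typeclass"
begin

definition finite_group :: "('a, 'b) monoid_scheme \<Rightarrow> bool" where
  "finite_group G \<longleftrightarrow> group G \<and> finite (carrier G)"

definition sur :: "('s, 'b) monoid_scheme \<Rightarrow> ('a, 'c) monoid_scheme \<Rightarrow> nat" where
  "sur S G = (if epi G S \<noteq> {} then 1 else 0)"

text \<open>
  A function from the class of finite groups to the naturals is represented by a function on the
  groups whose elements belong to one arbitrary infinite type. By the next lemma these
  include, up to isomorphism, all finite groups. A quotient or a product of groups over
  \<^typ>\<open>'u\<close> has elements of type \<^typ>\<open>'u set\<close> or \<^typ>\<open>'u \<times> 'u\<close>, so the axioms speak
  about all its isomorphic copies over \<^typ>\<open>'u\<close>. This does not depend on the copy: the quotient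
  axiom, applied to isomorphisms, makes such a function invariant under isomorphism.
\<close>

lemma ex_isomorphic_copy:
  fixes G :: "('a, 'b) monoid_scheme"
  assumes "finite_group G"
  shows "\<exists>Q :: 'u::infinite monoid. finite_group Q \<and> Q \<cong> G"
proof -
  interpret G: group G using assms by (simp add: finite_group_def)
  have fin: "finite (carrier G)" using assms by (simp add: finite_group_def)
  obtain f :: "'a \<Rightarrow> 'u" where f: "inj_on f (carrier G)"
    using arb_inj_on_finite_infinite[OF fin] by blast
  have iso: "f \<in> iso G (image_group f G)"
    using inj_imp_image_group_iso[OF f] .
  have "group (image_group f G)"
    using G.inj_imp_image_group_is_group[OF f] .
  moreover have "finite (carrier (image_group f G))"
    using fin by (simp add: image_group_def)
  moreover have "image_group f G \<cong> G"
    using G.iso_set_sym[OF iso] by (auto simp: is_iso_def)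
  ultimately show ?thesis unfolding finite_group_def by blast
qed

definition initial_condition :: "('u::infinite monoid \<Rightarrow> nat) \<Rightarrow> bool" where
  "initial_condition c \<longleftrightarrow> (\<forall>G. group G \<and> carrier G = {\<one>\<^bsub>G\<^esub>} \<longrightarrow> c G = 0)"

definition constructability_axiom :: "('u::infinite monoid \<Rightarrow> nat) \<Rightarrow> bool" where
  "constructability_axiom c \<longleftrightarrow>
     (\<forall>G :: 'u monoid. finite_group G \<longrightarrow>
       (\<exists>(n::nat) (H :: nat \<Rightarrow> 'u set).
          H 0 = carrier G \<and> H n = {\<one>\<^bsub>G\<^esub>} \<and>
          (\<forall>i<n. H (Suc i) \<lhd> G\<lparr>carrier := H i\<rparr> \<and>
             (\<forall>Q. finite_group Q \<and> Q \<cong> (G\<lparr>carrier := H i\<rparr> Mod H (Suc i)) \<longrightarrow> c Q \<le> 1))))"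

definition product_axiom :: "('u::infinite monoid \<Rightarrow> nat) \<Rightarrow> bool" where
  "product_axiom c \<longleftrightarrow>
     (\<forall>G H K. finite_group G \<and> finite_group H \<and> finite_group K \<and> G \<cong> H \<times>\<times> K \<longrightarrow>
        c G = max (c H) (c K))"

definition quotient_axiom :: "('u::infinite monoid \<Rightarrow> nat) \<Rightarrow> bool" where
  "quotient_axiom c \<longleftrightarrow>
     (\<forall>G H. finite_group G \<and> finite_group H \<and> epi G H \<noteq> {} \<longrightarrow> c H \<le> c G)"

definition extension_axiom :: "('u::infinite monoid \<Rightarrow> nat) \<Rightarrow> bool" where
  "extension_axiom c \<longleftrightarrow>
     (\<forall>G N Q. finite_group G \<and> N \<lhd> G \<and> finite_group Q \<and> Q \<cong> G Mod N \<longrightarrow>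
        c G \<le> c (G\<lparr>carrier := N\<rparr>) + c Q)"

definition complexity_function :: "('u::infinite monoid \<Rightarrow> nat) \<Rightarrow> bool" where
  "complexity_function c \<longleftrightarrow>
     extension_axiom c \<and> quotient_axiom c \<and> constructability_axiom c \<and>
     product_axiom c \<and> initial_condition c"

definition normal_subgroup_property :: "('u::infinite monoid \<Rightarrow> nat) \<Rightarrow> bool" where
  "normal_subgroup_property c \<longleftrightarrow>
     (\<forall>G N. finite_group G \<and> N \<lhd> G \<longrightarrow> c (G\<lparr>carrier := N\<rparr>) \<le> c G)"

end

theory Submission
  imports Defs
begin

text \<open>
  Constructability is immediate since \<^term>\<open>sur S\<close> never exceeds 1. For the extension and product
  axioms, an epimorphism onto the simple group \<open>S\<close> maps a normal subgroup either onto \<open>S\<close> or to 1.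

  For the failure of the normal subgroup property put \<open>q = |S| + 1\<close>, let \<open>W\<close> be the wreath product
  of \<open>S\<close> with the cyclic group of order \<open>q\<close>, and let \<open>R\<close> be the subgroup generated by the
  solutions of \<open>w\<^sup>q = 1\<close> in \<open>W\<close>. As \<open>s\<^sup>q = s\<close> in \<open>S\<close>, every homomorphism from \<open>R\<close> to \<open>S\<close> is trivial.
  But \<open>R\<close> is normal in \<open>W\<close> and contains the commutators of the cyclic shift with the base group,
  so a coordinate projection maps the intersection of \<open>R\<close> with the base group to a nontrivial
  normal subgroup of \<open>S\<close>, that is, onto \<open>S\<close>.
\<close>

section \<open>Epimorphisms onto a simple group\<close>

text \<open>Surjective homomorphisms carry normal subgroups to normal subgroups, and a simple group
  has only two of these.\<close>

lemma (in simple_group) hom_image_normal_cases: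
  assumes H: "group H" and f: "f \<in> epi H G" and N: "N \<lhd> H"
  shows "f ` N = carrier G \<or> f ` N = {\<one>}"
proof -
  have "group_hom H G f"
    using H f by (simp add: group_hom_def group_hom_axioms_def epi_def)
  then have "f ` N \<lhd> G"
    using f N by (intro normal.surj_hom_normal_subgroup) (auto simp: epi_def)
  then show ?thesis by (rule no_real_normal_subgroup)
qed

lemma (in simple_group) ex_nontrivial: "\<exists>s\<in>carrier G. s \<noteq> \<one>"
  using simple_not_triv by auto

lemma sur_le_1: "sur S G \<le> 1"
  by (simp add: sur_def)

lemma sur_mono: "epi G H \<noteq> {} \<Longrightarrow> sur S H \<le> sur S G"
  by (auto simp: sur_def dest: epi_compose)

lemma sur_iso:
  assumes "group G" "G \<cong> H"
  shows "sur S G = sur S H"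
proof (rule antisym)
  have "H \<cong> G" using assms by (rule group.iso_sym)
  then show "sur S G \<le> sur S H"
    by (intro sur_mono) (auto simp: is_iso_def iso_iff_mon_epi)
  show "sur S H \<le> sur S G"
    using assms by (intro sur_mono) (auto simp: is_iso_def iso_iff_mon_epi)
qed

text \<open>An epimorphism from \<open>H\<close> either stays surjective when restricted to
  \<open>N\<close>, or kills \<open>N\<close> and then factors through the quotient.\<close>

lemma (in simple_group) sur_extension:
  assumes "N \<lhd> H"
  shows "sur G H \<le> sur G (H\<lparr>carrier := N\<rparr>) + sur G (H Mod N)"
proof (cases "epi H G = {}")
  case False
  then obtain f where f: "f \<in> epi H G" by auto
  then have f_hom: "f \<in> hom H G" by (simp add: epi_def)
  interpret N: normal N H by fact
  consider "f ` N = carrier G" | "f ` N = {\<one>}"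
    using hom_image_normal_cases[OF N.is_group f assms] by blast
  then show ?thesis
  proof cases
    case 1
    then have "f \<in> epi (H\<lparr>carrier := N\<rparr>) G"
      using f N.subset by (auto simp: epi_def hom_def)
    then show ?thesis by (auto simp: sur_def)
  next
    case 2
    \<comment> \<open>Constancy on the cosets of \<open>N\<close> is what the universal property of
      the quotient requires.\<close>
    have same_image: "f x = f y"
      if "x \<in> carrier H" "y \<in> carrier H" "N #>\<^bsub>H\<^esub> x = N #>\<^bsub>H\<^esub> y" for x y
    proof -
      have "x \<in> N #>\<^bsub>H\<^esub> y" using that N.rcos_self[OF that(1) N.subgroup_axioms] by simp
      then obtain n where n: "n \<in> N" "x = n \<otimes>\<^bsub>H\<^esub> y" by (auto simp: r_coset_def)
      have "f n = \<one>" using 2 n by auto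
      then show ?thesis
        using n that f_hom hom_mult[OF f_hom N.mem_carrier[OF n(1)] that(2)] hom_in_carrier[OF f_hom that(2)]
        by simp
    qed
    obtain g where g: "g \<in> hom (H Mod N) G" "\<And>x. x \<in> carrier H \<Longrightarrow> g (N #>\<^bsub>H\<^esub> x) = f x"
      using FactGroup_universal[OF f_hom assms same_image] by blast
    have "g ` carrier (H Mod N) = f ` carrier H"
      using g(2) by (force simp: carrier_FactGroup)
    then have "g \<in> epi (H Mod N) G" using g(1) f by (simp add: epi_def)
    then show ?thesis by (auto simp: sur_def)
  qed
qed (simp add: sur_def)

text \<open>The projections are epimorphisms, which gives one inequality. For the other, the
  dichotomy is applied to the first factor, embedded as a normal subgroup: if its image is trivial,
  the second factor alone covers the simple group.\<close>

lemma (in simple_group) sur_DirProd: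
  assumes "group H" "group K"
  shows "sur G (H \<times>\<times> K) = max (sur G H) (sur G K)"
proof (rule antisym)
  interpret H: group H by fact
  interpret K: group K by fact
  interpret HK: group "H \<times>\<times> K" by (rule DirProd_group) fact+
  have "fst \<in> epi (H \<times>\<times> K) H" "snd \<in> epi (H \<times>\<times> K) K"
    by (force simp: epi_def hom_def image_iff)+
  then show "max (sur G H) (sur G K) \<le> sur G (H \<times>\<times> K)"
    by (auto intro!: sur_mono)
  show "sur G (H \<times>\<times> K) \<le> max (sur G H) (sur G K)"
  proof (cases "epi (H \<times>\<times> K) G = {}")
    case False
    then obtain f where f: "f \<in> epi (H \<times>\<times> K) G" by auto
    then have f_hom: "f \<in> hom (H \<times>\<times> K) G" by (simp add: epi_def)
    let ?i = "\<lambda>h. f (h, \<one>\<^bsub>K\<^esub>)" and ?j = "\<lambda>k. f (\<one>\<^bsub>H\<^esub>, k)"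
    have i: "?i \<in> hom H G" and j: "?j \<in> hom K G"
      using hom_mult[OF f_hom, of "(_, \<one>\<^bsub>K\<^esub>)" "(_, \<one>\<^bsub>K\<^esub>)"]
        hom_mult[OF f_hom, of "(\<one>\<^bsub>H\<^esub>, _)" "(\<one>\<^bsub>H\<^esub>, _)"]
      by (auto intro!: homI hom_in_carrier[OF f_hom])
    have "carrier H \<times> {\<one>\<^bsub>K\<^esub>} \<lhd> H \<times>\<times> K"
      by (auto simp: HK.normal_inv_iff intro!: DirProd_subgroups H.subgroup_self K.triv_subgroup assms)
    from hom_image_normal_cases[OF HK.is_group f this]
    consider "?i ` carrier H = carrier G" | "\<And>h. h \<in> carrier H \<Longrightarrow> ?i h = \<one>"
      by (auto simp: image_image image_def)
    then show ?thesis
    proof cases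
      case 1
      then have "?i \<in> epi H G" using i by (simp add: epi_def)
      then have "epi H G \<noteq> {}" by blast
      then show ?thesis by (simp add: sur_def)
    next
      case 2
      have f_eq: "f (h, k) = ?j k" if "h \<in> carrier H" "k \<in> carrier K" for h k
        using hom_mult[OF f_hom, of "(h, \<one>\<^bsub>K\<^esub>)" "(\<one>\<^bsub>H\<^esub>, k)"] that 2 hom_in_carrier[OF j]
        by simp
      have "f x \<in> ?j ` carrier K" if "x \<in> carrier (H \<times>\<times> K)" for x
        using that f_eq[of "fst x" "snd x"] by (cases x) auto
      then have "f ` carrier (H \<times>\<times> K) \<subseteq> ?j ` carrier K" by blast
      then have "carrier G \<subseteq> ?j ` carrier K" using f by (simp add: epi_def)
      then have "?j \<in> epi K G" using j by (auto simp: epi_def hom_def)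
      then have "epi K G \<noteq> {}" by blast
      then show ?thesis by (simp add: sur_def)
    qed
  qed (simp add: sur_def)
qed

section \<open>Semidirect products with a cyclic group\<close>

text \<open>This is the semidirect product of \<open>H\<close> with Z/q, where the generator acts by
  \<open>\<alpha>\<close> and residues are stored as naturals below \<open>q\<close>.\<close>

definition cyclic_extension :: "('a, 'b) monoid_scheme \<Rightarrow> ('a \<Rightarrow> 'a) \<Rightarrow> nat \<Rightarrow> ('a \<times> nat) monoid" where
  "cyclic_extension H \<alpha> q =
     \<lparr>carrier = carrier H \<times> {..<q},
      monoid.mult = \<lambda>(x, i) (y, j). (x \<otimes>\<^bsub>H\<^esub> (\<alpha> ^^ i) y, (i + j) mod q),
      one = (\<one>\<^bsub>H\<^esub>, 0)\<rparr>"

lemma cyclic_extension_simps [simp]: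
  "carrier (cyclic_extension H \<alpha> q) = carrier H \<times> {..<q}"
  "(x, i) \<otimes>\<^bsub>cyclic_extension H \<alpha> q\<^esub> (y, j) = (x \<otimes>\<^bsub>H\<^esub> (\<alpha> ^^ i) y, (i + j) mod q)"
  "\<one>\<^bsub>cyclic_extension H \<alpha> q\<^esub> = (\<one>\<^bsub>H\<^esub>, 0)"
  by (simp_all add: cyclic_extension_def)

text \<open>The period condition makes \<open>\<alpha>\<close> an automorphism whose powers depend
  only on the exponent modulo \<open>q\<close>, so Z/q acts on \<open>H\<close>.\<close>

locale cyclic_action = group H for H :: "('a, 'b) monoid_scheme" (structure) +
  fixes \<alpha> :: "'a \<Rightarrow> 'a" and q :: nat
  assumes action_hom: "\<alpha> \<in> hom H H"
    and action_period: "\<And>x. x \<in> carrier H \<Longrightarrow> (\<alpha> ^^ q) x = x"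
    and q_pos: "0 < q"
begin

lemma action_pow_hom: "\<alpha> ^^ n \<in> hom H H"
proof (induction n)
  case (Suc n)
  then show ?case using Group.hom_compose[OF Suc action_hom] by (simp add: o_def)
qed (simp add: hom_def id_def)

lemmas action_pow_closed = hom_in_carrier[OF action_pow_hom]

lemmas action_pow_mult = hom_mult[OF action_pow_hom]

lemma action_pow_one: "(\<alpha> ^^ n) \<one> = \<one>"
  using hom_one[OF action_pow_hom] is_group by blast

lemma action_pow_mod:
  assumes "x \<in> carrier H"
  shows "(\<alpha> ^^ (n mod q)) x = (\<alpha> ^^ n) x"
proof -
  have "(\<alpha> ^^ (q * k)) x = x" for k
    by (induction k) (simp_all add: funpow_add action_period assms)
  moreover have "\<alpha> ^^ n = \<alpha> ^^ (n mod q) \<circ> \<alpha> ^^ (q * (n div q))"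
    by (simp flip: funpow_add)
  ultimately show ?thesis by simp
qed

lemma group_cyclic_extension: "group (cyclic_extension H \<alpha> q)"
proof (rule groupI)
  fix x y z
  assume "x \<in> carrier (cyclic_extension H \<alpha> q)" "y \<in> carrier (cyclic_extension H \<alpha> q)"
    "z \<in> carrier (cyclic_extension H \<alpha> q)"
  then show "x \<otimes>\<^bsub>cyclic_extension H \<alpha> q\<^esub> y \<otimes>\<^bsub>cyclic_extension H \<alpha> q\<^esub> z =
      x \<otimes>\<^bsub>cyclic_extension H \<alpha> q\<^esub> (y \<otimes>\<^bsub>cyclic_extension H \<alpha> q\<^esub> z)"
    by (auto simp: action_pow_mod action_pow_mult action_pow_closed funpow_add m_assoc mod_simps add.assoc)
next
  fix x
  assume x: "x \<in> carrier (cyclic_extension H \<alpha> q)"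
  then obtain h i where hi: "x = (h, i)" "h \<in> carrier H" "i < q" by auto
  \<comment> \<open>The exponent \<open>q - i\<close> stands for \<open>-i\<close>; the reduction
    modulo \<open>q\<close> matters for \<open>i = 0\<close>, where \<open>q - i\<close> is not a
    valid second component.\<close>
  let ?y = "((\<alpha> ^^ (q - i)) (inv h), (q - i) mod q)"
  have "?y \<otimes>\<^bsub>cyclic_extension H \<alpha> q\<^esub> x = \<one>\<^bsub>cyclic_extension H \<alpha> q\<^esub>"
    using hi by (simp add: action_pow_mod action_pow_one mod_simps flip: action_pow_mult)
  moreover have "?y \<in> carrier (cyclic_extension H \<alpha> q)"
    using hi q_pos by (simp add: action_pow_closed)
  ultimately show "\<exists>y\<in>carrier (cyclic_extension H \<alpha> q).
      y \<otimes>\<^bsub>cyclic_extension H \<alpha> q\<^esub> x = \<one>\<^bsub>cyclic_extension H \<alpha> q\<^esub>" by blast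
qed (use q_pos in \<open>auto simp: action_pow_closed\<close>)

text \<open>The base group is the kernel of the projection to Z/q.\<close>

lemma base_normal: "carrier H \<times> {0} \<lhd> cyclic_extension H \<alpha> q"
proof -
  let ?W = "cyclic_extension H \<alpha> q" and ?p = "\<lambda>x. int (snd x)"
  have "group_hom ?W (integer_mod_group q) ?p"
    using q_pos by (auto simp: group_hom_def group_hom_axioms_def group_cyclic_extension
        intro!: homI simp: carrier_integer_mod_group zmod_int)
  then have "kernel ?W (integer_mod_group q) ?p \<lhd> ?W"
    by (rule group_hom.normal_kernel)
  moreover have "kernel ?W (integer_mod_group q) ?p = carrier H \<times> {0}"
    using q_pos by (auto simp: kernel_def)
  ultimately show ?thesis by simp
qed

lemma generator_pow: "(\<one>, 1 mod q) [^]\<^bsub>cyclic_extension H \<alpha> q\<^esub> (n::nat) = (\<one>, n mod q)"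
  by (induction n) (simp_all add: nat_pow_def action_pow_one mod_simps)

end

section \<open>The normal subgroup generated by the solutions of a power equation\<close>

lemma (in group) conj_nat_pow:
  assumes "g \<in> carrier G" "x \<in> carrier G"
  shows "(g \<otimes> x \<otimes> inv g) [^] (n::nat) = g \<otimes> x [^] n \<otimes> inv g"
proof (induction n)
  case (Suc n)
  have cancel: "inv g \<otimes> (g \<otimes> y) = y" if "y \<in> carrier G" for y
    using that assms by (simp flip: m_assoc)
  have "g \<otimes> x [^] n \<otimes> inv g \<otimes> (g \<otimes> x \<otimes> inv g) = g \<otimes> x [^] n \<otimes> x \<otimes> inv g"
    using assms cancel by (simp add: m_assoc)
  then show ?case using Suc assms by (simp add: m_assoc)
qed (use assms in simp)

definition roots_subgroup :: "('a, 'b) monoid_scheme \<Rightarrow> nat \<Rightarrow> 'a set" where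
  "roots_subgroup G n = generate G {x \<in> carrier G. x [^]\<^bsub>G\<^esub> n = \<one>\<^bsub>G\<^esub>}"

text \<open>Conjugation commutes with powers, so it permutes the generators.\<close>

lemma (in group) roots_subgroup_normal: "roots_subgroup G n \<lhd> G"
  unfolding roots_subgroup_def
  by (rule normal_generateI) (auto simp: conj_nat_pow)

text \<open>Raising to the power \<open>Suc (order K)\<close> is the identity on \<open>K\<close>,
  yet it sends each generator to 1. Hence every generator has trivial image.\<close>

lemma (in group) hom_roots_subgroup_trivial:
  assumes K: "group K" "finite (carrier K)"
    and h: "h \<in> hom (G\<lparr>carrier := roots_subgroup G (Suc (order K))\<rparr>) K"
    and x: "x \<in> roots_subgroup G (Suc (order K))"
  shows "h x = \<one>\<^bsub>K\<^esub>"
proof -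
  let ?R = "roots_subgroup G (Suc (order K))"
  let ?GR = "G\<lparr>carrier := ?R\<rparr>"
  interpret K: group K by fact
  interpret R: subgroup ?R G by (rule normal_imp_subgroup[OF roots_subgroup_normal])
  interpret h: group_hom ?GR K h
    using h R.subgroup_is_group[OF is_group] K by (simp add: group_hom_def group_hom_axioms_def)
  have root: "h w = \<one>\<^bsub>K\<^esub>" if w: "w \<in> carrier G" "w [^] Suc (order K) = \<one>" for w
  proof -
    have wR: "w \<in> ?R" using w unfolding roots_subgroup_def by (intro generate.incl) simp
    \<comment> \<open>Since \<open>h\<close> is a homomorphism on the subgroup only, the power is
      first taken there and then identified with the power in \<open>G\<close>.\<close>
    have "h w [^]\<^bsub>K\<^esub> Suc (order K) = h (w [^]\<^bsub>?GR\<^esub> Suc (order K))"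
      using h.hom_nat_pow[of w "Suc (order K)"] wR by (simp del: nat_pow_Suc K.nat_pow_Suc)
    also have "w [^]\<^bsub>?GR\<^esub> Suc (order K) = \<one>"
      using w nat_pow_consistent[of w "Suc (order K)" ?R] by simp
    also have "h \<one> = \<one>\<^bsub>K\<^esub>" using h.hom_one by simp
    finally show ?thesis
      using h.hom_closed[of w] wR K.pow_order_eq_1[of "h w"] by simp
  qed
  from x show ?thesis
    unfolding roots_subgroup_def
  proof (induction x rule: generate.induct)
    case one
    show ?case using h.hom_one by simp
  next
    case (incl w)
    then show ?case using root by simp
  next
    case (inv w)
    then have "inv w [^] Suc (order K) = \<one>" using nat_pow_inv[of w "Suc (order K)"] by simp
    then show ?case using root inv by simp
  next
    case (eng x y)
    then show ?case using h.hom_mult[of x y] by (simp add: roots_subgroup_def)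
  qed
qed

section \<open>The wreath product and its root subgroup\<close>

text \<open>The \<open>n\<close>-th iterate moves indices by \<open>n\<close> modulo
  \<open>q\<close>, so the \<open>q\<close>-th one is the identity on extensional functions.\<close>

lemma (in group) cyclic_action_shift:
  assumes "0 < q"
  shows "cyclic_action (product_group {..<q} (\<lambda>_. G)) (\<lambda>f. \<lambda>i\<in>{..<q}. f (Suc i mod q)) q"
proof -
  let ?H = "product_group {..<q} (\<lambda>_. G)" and ?\<alpha> = "\<lambda>f. \<lambda>i\<in>{..<q}. f (Suc i mod q)"
  have "(?\<alpha> ^^ n) f = (\<lambda>i\<in>{..<q}. f ((i + n) mod q))" if "f \<in> carrier ?H" for f n
  proof (induction n)
    case 0
    then show ?case using that by (auto simp: PiE_iff extensional_def)
  next
    case (Suc n)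
    then show ?case using assms by (auto simp: mod_simps restrict_def)
  qed
  then have "(?\<alpha> ^^ q) f = f" if "f \<in> carrier ?H" for f
    using that by (auto simp: PiE_iff extensional_def)
  moreover have "?\<alpha> \<in> hom ?H ?H"
    using assms by (auto intro!: homI simp: PiE_iff)
  moreover have "group ?H" by (simp add: is_group)
  ultimately show ?thesis
    using assms unfolding cyclic_action_def cyclic_action_axioms_def by blast
qed

theorem (in simple_group) ex_normal_subgroup_larger_sur:
  assumes fin: "finite (carrier G)"
  shows "\<exists>(R :: ((nat \<Rightarrow> 'a) \<times> nat) monoid) N.
    finite_group R \<and> N \<lhd> R \<and> epi R G = {} \<and> epi (R\<lparr>carrier := N\<rparr>) G \<noteq> {}"
proof -
  define q where "q = Suc (order G)"
  \<comment> \<open>The coordinates 0 and 1 must be distinct for the commutator computed below to be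
    nontrivial at coordinate 0.\<close>
  have q: "0 < q" "1 < q" "Suc 0 mod q = 1" using order_gt_one by (auto simp: q_def)
  define H where "H = product_group {..<q} (\<lambda>_. G)"
  define \<alpha> where "\<alpha> = (\<lambda>f. \<lambda>i\<in>{..<q}. f (Suc i mod q) :: 'a)"
  interpret H: cyclic_action H \<alpha> q
    unfolding H_def \<alpha>_def using q by (intro cyclic_action_shift)
  define W where "W = cyclic_extension H \<alpha> q"
  interpret W: group W unfolding W_def by (rule H.group_cyclic_extension)
  define R where "R = roots_subgroup W q"
  define B where "B = carrier H \<times> {0::nat}"
  have R: "R \<lhd> W" unfolding R_def by (rule W.roots_subgroup_normal)
  interpret R: normal R W by (rule R)
  have B: "B \<lhd> W" unfolding B_def W_def by (rule H.base_normal)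
  let ?WR = "W\<lparr>carrier := R\<rparr>"
  have "finite (carrier W)"
    using fin by (auto simp: W_def H_def intro!: finite_PiE)
  then have "finite R" using R.subset finite_subset by blast
  then have finR: "finite_group ?WR"
    using R.subgroup_is_group[OF W.is_group] by (simp add: finite_group_def)
  have no_epi: "epi ?WR G = {}"
  proof (rule ccontr)
    assume "epi ?WR G \<noteq> {}"
    then obtain h where h: "h \<in> hom ?WR G" "h ` R = carrier G" by (auto simp: epi_def)
    then have "carrier G \<subseteq> {\<one>}"
      using W.hom_roots_subgroup_trivial[OF is_group fin] by (auto simp: R_def q_def)
    then show False using ex_nontrivial by auto
  qed
  have N_normal_W: "B \<inter> R \<lhd> W"
    using W.normal_subgroup_intersect[OF B R] .
  have N: "B \<inter> R \<lhd> ?WR"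
    using W.normal_Int_subgroup[OF R.subgroup_axioms B] .
  \<comment> \<open>Reading coordinate 0 is multiplicative on \<open>B\<close>, where the second
    components are 0 and no shift interferes.\<close>
  define p where "p = (\<lambda>w :: (nat \<Rightarrow> 'a) \<times> nat. fst w 0)"
  have p: "p \<in> epi (W\<lparr>carrier := B\<rparr>) G"
  proof -
    have "p \<in> hom (W\<lparr>carrier := B\<rparr>) G"
      using q by (auto intro!: homI simp: p_def B_def W_def H_def PiE_iff)
    moreover have "s \<in> p ` B" if "s \<in> carrier G" for s
      using that q by (intro image_eqI[of _ _ "(\<lambda>i\<in>{..<q}. s, 0)"]) (simp_all add: p_def B_def H_def)
    ultimately show ?thesis by (auto simp: epi_def hom_def)
  qed
  interpret B: normal B W by (rule B)
  have N_normal_B: "B \<inter> R \<lhd> W\<lparr>carrier := B\<rparr>"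
    by (rule W.normal_restrict_supergroup[OF B.subgroup_axioms N_normal_W]) simp
  have "p ` (B \<inter> R) \<noteq> {\<one>}"
  proof -
    obtain s where s: "s \<in> carrier G" "s \<noteq> \<one>" using ex_nontrivial by blast
    define f where "f = (\<lambda>i\<in>{..<q}. if i = 0 then s else \<one>)"
    define b where "b = (f, 0::nat)"
    define \<sigma> where "\<sigma> = (\<one>\<^bsub>H\<^esub>, 1::nat)"
    have f: "f \<in> carrier H" using s by (auto simp: f_def H_def)
    have b: "b \<in> carrier W" and \<sigma>: "\<sigma> \<in> carrier W"
      using f q by (auto simp: b_def \<sigma>_def W_def)
    have b_B: "b \<in> B" using f by (simp add: b_def B_def)
    have "\<sigma> [^]\<^bsub>W\<^esub> q = \<one>\<^bsub>W\<^esub>"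
      using H.generator_pow[of q] q by (simp add: \<sigma>_def W_def)
    then have \<sigma>_R: "\<sigma> \<in> R" using \<sigma> unfolding R_def roots_subgroup_def by (intro generate.incl) simp
    define c where "c = \<sigma> \<otimes>\<^bsub>W\<^esub> b \<otimes>\<^bsub>W\<^esub> inv\<^bsub>W\<^esub> \<sigma>"
    have c_B: "c \<in> B" unfolding c_def using B.inv_op_closed2[OF \<sigma> b_B] .
    \<comment> \<open>This is the commutator of \<open>b\<close> and \<open>\<sigma>\<close>. As
      \<open>b\<close> times the inverse of \<open>c\<close> it lies in \<open>B\<close>; as a
      conjugate of \<open>\<sigma>\<close> times the inverse of \<open>\<sigma>\<close> it lies in
      \<open>R\<close>.\<close>
    define d where "d = b \<otimes>\<^bsub>W\<^esub> inv\<^bsub>W\<^esub> c"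
    have "d = b \<otimes>\<^bsub>W\<^esub> \<sigma> \<otimes>\<^bsub>W\<^esub> inv\<^bsub>W\<^esub> b \<otimes>\<^bsub>W\<^esub> inv\<^bsub>W\<^esub> \<sigma>"
      using b \<sigma> by (simp add: d_def c_def W.inv_mult_group W.m_assoc)
    then have d_R: "d \<in> R"
      using R.inv_op_closed2[OF b \<sigma>_R] \<sigma>_R by (simp add: R.m_closed R.m_inv_closed)
    have d_B: "d \<in> B" using b_B c_B by (simp add: d_def)
    \<comment> \<open>Comparing first components here shows that \<open>c\<close> is the shift of
      \<open>b\<close>, without computing an inverse in \<open>W\<close>. Its coordinate 0 is then
      \<open>f 1\<close>, which is trivial, so \<open>d\<close> keeps the value \<open>s\<close> of
      \<open>b\<close> there.\<close>
    have "c \<otimes>\<^bsub>W\<^esub> \<sigma> = \<sigma> \<otimes>\<^bsub>W\<^esub> b"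
      using b \<sigma> by (simp add: c_def W.m_assoc)
    moreover obtain g where g: "c = (g, 0)" "g \<in> carrier H" using c_B by (auto simp: B_def)
    ultimately have "g = \<alpha> f"
      using f H.action_pow_closed[OF f, of 1] by (simp add: \<sigma>_def b_def W_def)
    then have "p c = \<one>" using g q by (simp add: p_def \<alpha>_def f_def)
    moreover have "p d \<otimes> p c = p b"
    proof -
      have "d \<otimes>\<^bsub>W\<^esub> c = b" using b c_B by (simp add: d_def W.m_assoc)
      then show ?thesis using hom_mult[of p "W\<lparr>carrier := B\<rparr>" G d c] p d_B c_B by (simp add: epi_def)
    qed
    moreover have "p d \<in> carrier G" using p d_B by (auto simp: epi_def)
    ultimately have "p d = s" using q by (simp add: p_def b_def f_def)
    then show ?thesis using d_R d_B s by blast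
  qed
  then have "p ` (B \<inter> R) = carrier G"
    using hom_image_normal_cases[OF B.subgroup_is_group[OF W.is_group] p N_normal_B] by blast
  then have "p \<in> epi (?WR\<lparr>carrier := B \<inter> R\<rparr>) G"
    using p by (auto simp: epi_def hom_def)
  then show ?thesis using finR N no_epi by (metis empty_iff)
qed

section \<open>Transfer to an arbitrary infinite type, and the axioms\<close>

text \<open>Needed because the counterexample lives on pairs of a function and a number, while the
  axioms speak about groups over \<open>'u\<close>. An isomorphism carries the normal subgroup along
  with the group.\<close>

lemma ex_isomorphic_copy_normal:
  fixes R :: "('a, 'b) monoid_scheme"
  assumes R: "finite_group R" and N: "N \<lhd> R"
  obtains Q :: "'u::infinite monoid" and M where
    "finite_group Q" "Q \<cong> R" "M \<lhd> Q" "R\<lparr>carrier := N\<rparr> \<cong> Q\<lparr>carrier := M\<rparr>"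
proof -
  obtain Q :: "'u monoid" where Q: "finite_group Q" "Q \<cong> R"
    using ex_isomorphic_copy[OF R] by blast
  have groups: "group R" "group Q" using R Q by (auto simp: finite_group_def)
  obtain f where f: "f \<in> iso R Q"
    using group.iso_sym[OF groups(2) Q(2)] by (auto simp: is_iso_def)
  have "f ` N \<lhd> Q" using iso_normal_subgroup[OF f groups N] .
  moreover have "N \<subseteq> carrier R" using N normal_imp_subgroup subgroup.subset by blast
  then have "f \<in> iso (R\<lparr>carrier := N\<rparr>) (Q\<lparr>carrier := f ` N\<rparr>)"
    using f by (auto simp: iso_def hom_def bij_betw_def inj_on_def subset_iff)
  then have "R\<lparr>carrier := N\<rparr> \<cong> Q\<lparr>carrier := f ` N\<rparr>" by (auto simp: is_iso_def)
  ultimately show thesis using that Q by blast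
qed

theorem proposition7p1:
  fixes S :: "'s monoid"
  assumes "simple_group S" and "finite (carrier S)"
  shows "initial_condition (sur S :: 'u::infinite monoid \<Rightarrow> nat) \<and>
         constructability_axiom (sur S :: 'u monoid \<Rightarrow> nat) \<and>
         product_axiom (sur S :: 'u monoid \<Rightarrow> nat) \<and>
         quotient_axiom (sur S :: 'u monoid \<Rightarrow> nat) \<and>
         extension_axiom (sur S :: 'u monoid \<Rightarrow> nat) \<and>
         complexity_function (sur S :: 'u monoid \<Rightarrow> nat) \<and>
         \<not> normal_subgroup_property (sur S :: 'u monoid \<Rightarrow> nat) \<and>
         (\<exists>(G :: 'u monoid) N. finite_group G \<and> N \<lhd> G \<and> sur S (G\<lparr>carrier := N\<rparr>) > sur S G)"
proof -
  interpret S: simple_group S by fact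
  have initial: "initial_condition (sur S :: 'u monoid \<Rightarrow> nat)"
    unfolding initial_condition_def
  proof (intro allI impI)
    fix G :: "'u monoid"
    assume "group G \<and> carrier G = {\<one>\<^bsub>G\<^esub>}"
    then have G: "group G" "carrier G = {\<one>\<^bsub>G\<^esub>}" by auto
    have "carrier S = {\<one>\<^bsub>S\<^esub>}" if "f \<in> epi G S" for f
      using that G hom_one[OF _ G(1) S.is_group, of f] by (auto simp: epi_def)
    then show "sur S G = 0" using S.simple_not_triv by (auto simp: sur_def)
  qed
  have constructability: "constructability_axiom (sur S :: 'u monoid \<Rightarrow> nat)"
    unfolding constructability_axiom_def
  proof (intro allI impI)
    fix G :: "'u monoid"
    assume "finite_group G"
    then have "{\<one>\<^bsub>G\<^esub>} \<lhd> G" by (simp add: finite_group_def group.one_is_normal)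
    then show "\<exists>n H. H 0 = carrier G \<and> H n = {\<one>\<^bsub>G\<^esub>} \<and>
        (\<forall>i<n. H (Suc i) \<lhd> G\<lparr>carrier := H i\<rparr> \<and>
          (\<forall>Q :: 'u monoid. finite_group Q \<and> Q \<cong> (G\<lparr>carrier := H i\<rparr> Mod H (Suc i)) \<longrightarrow> sur S Q \<le> 1))"
      \<comment> \<open>The series from \<open>G\<close> directly to the trivial subgroup
        suffices.\<close>
      by (intro exI[of _ 1] exI[of _ "\<lambda>i. if i = 0 then carrier G else {\<one>\<^bsub>G\<^esub>}"])
        (simp add: sur_le_1[unfolded One_nat_def])
  qed
  have product: "product_axiom (sur S :: 'u monoid \<Rightarrow> nat)"
    \<comment> \<open>The axiom concerns copies of the product over \<open>'u\<close>; isomorphism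
      invariance reduces it to the actual product.\<close>
    unfolding product_axiom_def using sur_iso S.sur_DirProd
    by (metis finite_group_def)
  have quotient: "quotient_axiom (sur S :: 'u monoid \<Rightarrow> nat)"
    unfolding quotient_axiom_def using sur_mono by blast
  have extension: "extension_axiom (sur S :: 'u monoid \<Rightarrow> nat)"
    unfolding extension_axiom_def using sur_iso S.sur_extension
    by (metis finite_group_def)
  obtain R :: "((nat \<Rightarrow> 's) \<times> nat) monoid" and N where R:
    "finite_group R" "N \<lhd> R" "epi R S = {}" "epi (R\<lparr>carrier := N\<rparr>) S \<noteq> {}"
    using S.ex_normal_subgroup_larger_sur[OF assms(2)] by blast
  obtain G :: "'u monoid" and M where G:
    "finite_group G" "G \<cong> R" "M \<lhd> G" "R\<lparr>carrier := N\<rparr> \<cong> G\<lparr>carrier := M\<rparr>"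
    using ex_isomorphic_copy_normal[OF R(1,2)] by blast
  have "sur S G = sur S R"
    using G by (intro sur_iso) (simp_all add: finite_group_def)
  moreover have "sur S (R\<lparr>carrier := N\<rparr>) = sur S (G\<lparr>carrier := M\<rparr>)"
    using R G by (intro sur_iso subgroup.subgroup_is_group normal_imp_subgroup)
      (simp_all add: finite_group_def)
  ultimately have "sur S G < sur S (G\<lparr>carrier := M\<rparr>)" using R by (simp add: sur_def)
  then have counterexample:
    "\<exists>(G :: 'u monoid) N. finite_group G \<and> N \<lhd> G \<and> sur S (G\<lparr>carrier := N\<rparr>) > sur S G"
    using G by blast
  then have "\<not> normal_subgroup_property (sur S :: 'u monoid \<Rightarrow> nat)"
    by (auto simp: normal_subgroup_property_def not_le)
  then show ?thesis
    using initial constructability product quotient extension counterexample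
    by (simp add: complexity_function_def)
qed

end
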